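(* Let $\omega^1,\omega^2,\omega^3,\omega^4$ be four independent samples, each $\omega^r = (X_{r,k})_{k\ge 1}$ being a sequence of independent Poisson random variables with $\mathbb{E} X_{r,k} = 1/k$. Then, with probability $1$, the set $\bigcap_{r=1}^4 S(\omega^r)$ is finite.
   Context: For a sequence $\omega = (X_k)_{k \geq 1}$ of nonnegative integers, the sumset is $$S(\omega) := \left\{ \sum_{k\ge 1} a_k\, k : a_k \in \mathbb{Z}_{\ge 0},\ a_k \leq X_k \text{ for all } k,\ a_k = 0 \text{ for all but finitely many } k \right\},$$ i.e. the set of all sums of finite sub-multisets of the multiset containing $X_k$ copies of each positive integer $k$. *)

theory Defs
  imports "HOL-Probability.Probability"
begin

(* A sequence indexed by the positive integers is a function on nat; its value at 0 is ignored. *)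
definition sumset :: "(nat \<Rightarrow> nat) \<Rightarrow> nat set" where
  "sumset x = {(\<Sum>k | 1 \<le> k \<and> a k \<noteq> 0. a k * k) | a.
     (\<forall>k\<ge>1. a k \<le> x k) \<and> finite {k. 1 \<le> k \<and> a k \<noteq> 0}}"

end

theory Submission
  imports Defs
begin

text \<open>
  Let \<open>N\<close> be the number of parts of size at most \<open>m = 2 ^ (J + 1)\<close> in a sample, a Poisson variable of
  mean about \<open>ln m\<close>. Since \<open>37/50 > ln 2\<close>, a Chernoff bound and Borel--Cantelli give
  \<open>N \<le> 37/50 * J\<close> for all large \<open>J\<close>. For \<open>2 ^ J \<le> n < m\<close> the probability that \<open>n\<close> lies in the sumset while
  \<open>N \<le> u\<close> is at most \<open>2 powr u\<close> times the expected number of multiplicity functions of sum \<open>n\<close> below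
  the sample, each weighted by \<open>2 powr (- N)\<close>. For Poisson variables this expectation is at most
  \<open>exp (- harm m / 2)\<close> times a power series coefficient of order \<open>1 / sqrt n\<close>. So the probability is at most
  \<open>2 powr (- 13/50 * J)\<close>. As \<open>4 * 13/50 > 1\<close>, the fourth powers are summable over all \<open>n\<close>.
  Without the restriction on \<open>N\<close> the first moment is dominated by rare samples with many parts
  and gives no useful bound; the tilt \<open>1/2\<close> is the optimal one.
\<close>

section \<open>Multiplicity functions, their Poisson weights and a recursion for the total
  weight\<close>

text \<open>These encode the partitions of \<open>n\<close> into parts of size at most
  \<open>m\<close>. Forcing the value 0 outside \<open>{1..m}\<close> makes the encoding unique and
  the set finite.\<close>

definition mult_functions :: "nat \<Rightarrow> nat \<Rightarrow> (nat \<Rightarrow> nat) set" where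
  "mult_functions m n = {a. (\<forall>k. k \<notin> {1..m} \<longrightarrow> a k = 0) \<and> (\<Sum>k=1..m. a k * k) = n}"

text \<open>Up to the factor \<open>exp (- t * harm m)\<close>, this is the probability that
  independent Poisson variables of means \<open>t / k\<close> take the values
  \<open>a k\<close>.\<close>

definition poisson_weight :: "real \<Rightarrow> nat \<Rightarrow> (nat \<Rightarrow> nat) \<Rightarrow> real" where
  "poisson_weight t m a = (\<Prod>k=1..m. (t / real k) ^ a k / fact (a k))"

definition weight_sum :: "real \<Rightarrow> nat \<Rightarrow> nat \<Rightarrow> real" where
  "weight_sum t m n = (\<Sum>a\<in>mult_functions m n. poisson_weight t m a)"

lemma finite_mult_functions: "finite (mult_functions m n)"
proof (rule finite_subset)
  show "finite {a. \<forall>k. (k \<in> {1..m} \<longrightarrow> a k \<in> {..n}) \<and> (k \<notin> {1..m} \<longrightarrow> a k = 0)}"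
    by (rule finite_set_of_finite_funs) auto
  show "mult_functions m n \<subseteq> {a. \<forall>k. (k \<in> {1..m} \<longrightarrow> a k \<in> {..n}) \<and> (k \<notin> {1..m} \<longrightarrow> a k = 0)}"
  proof (clarsimp simp: mult_functions_def)
    fix a :: "nat \<Rightarrow> nat" and k assume k: "Suc 0 \<le> k" "k \<le> m"
    have "a k * k \<le> (\<Sum>k=Suc 0..m. a k * k)"
      by (rule member_le_sum) (use k in auto)
    moreover have "a k \<le> a k * k" using k by simp
    ultimately show "a k \<le> (\<Sum>k=Suc 0..m. a k * k)" by linarith
  qed
qed

lemma poisson_weight_nonneg: "t \<ge> 0 \<Longrightarrow> poisson_weight t m a \<ge> 0"
  unfolding poisson_weight_def by (intro prod_nonneg) auto

lemma weight_sum_nonneg: "t \<ge> 0 \<Longrightarrow> weight_sum t m n \<ge> 0"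
  unfolding weight_sum_def by (intro sum_nonneg poisson_weight_nonneg)

lemma weight_sum_0: "weight_sum t m 0 = 1"
proof -
  have "mult_functions m 0 = {\<lambda>_. 0}"
    by (force simp: mult_functions_def fun_eq_iff)
  then show ?thesis by (simp add: weight_sum_def poisson_weight_def)
qed

lemma poisson_weight_upd:
  assumes "k \<in> {1..m}"
  shows "real (k * Suc (a k)) * poisson_weight t m (a(k := Suc (a k))) = t * poisson_weight t m a"
proof -
  have "(\<Prod>i\<in>{1..m} - {k}. (t / real i) ^ (a(k := Suc (a k))) i / fact ((a(k := Suc (a k))) i)) =
        (\<Prod>i\<in>{1..m} - {k}. (t / real i) ^ a i / fact (a i))"
    by (intro prod.cong) auto
  then show ?thesis
    unfolding poisson_weight_def using assms
    by (simp add: prod.remove[of _ k] divide_simps) (simp add: algebra_simps)?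
qed

text \<open>The replaced term is added on the left instead of subtracted on the right, which avoids
  truncated subtraction.\<close>

lemma sum_upd:
  assumes "k \<in> {1..m}"
  shows "(\<Sum>i=1..m. (a(k := y)) i * i) + a k * k = (\<Sum>i=1..m. a i * i) + y * (k::nat)"
proof -
  have "(\<Sum>i\<in>{1..m} - {k}. (a(k := y)) i * i) = (\<Sum>i\<in>{1..m} - {k}. a i * i)"
    by (intro sum.cong) auto
  then show ?thesis using assms by (simp add: sum.remove[of _ k])
qed

text \<open>Removing one copy of \<open>k\<close> is a bijection from the functions with
  \<open>a k > 0\<close> onto \<open>mult_functions m (n - k)\<close>, and the factor
  \<open>k * a k\<close> turns the change of weight into the constant \<open>t\<close>. If
  \<open>k > n\<close>, no copy of \<open>k\<close> can occur.\<close>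

lemma weighted_sum_shift:
  assumes k: "k \<in> {1..m}"
  shows "(\<Sum>a\<in>mult_functions m n. real (k * a k) * poisson_weight t m a)
     = (if k \<le> n then t * weight_sum t m (n - k) else 0)"
proof -
  have "(\<Sum>a\<in>mult_functions m n. real (k * a k) * poisson_weight t m a)
     = (\<Sum>a\<in>{a\<in>mult_functions m n. a k \<noteq> 0}. real (k * a k) * poisson_weight t m a)"
    by (rule sum.mono_neutral_right) (auto simp: finite_mult_functions)
  also have "\<dots> = (if k \<le> n then t * weight_sum t m (n - k) else 0)"
  proof (cases "k \<le> n")
    case True
    have "(\<Sum>a\<in>{a\<in>mult_functions m n. a k \<noteq> 0}. real (k * a k) * poisson_weight t m a)
        = (\<Sum>a\<in>mult_functions m (n - k). t * poisson_weight t m a)"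
    proof (rule sum.reindex_bij_witness[where i="\<lambda>a. a(k := Suc (a k))" and j="\<lambda>a. a(k := a k - 1)"])
      fix a assume "a \<in> {a \<in> mult_functions m n. a k \<noteq> 0}"
      then have a: "\<And>i. i \<notin> {1..m} \<Longrightarrow> a i = 0" "(\<Sum>i=1..m. a i * i) = n" "a k \<noteq> 0"
        by (auto simp: mult_functions_def)
      show eq: "(a(k := a k - 1))(k := Suc ((a(k := a k - 1)) k)) = a"
        using a by (auto simp: fun_eq_iff)
      have "(a k - 1) * k + k = a k * k"
        using a(3) by (cases "a k") auto
      then have "(\<Sum>i=1..m. (a(k := a k - 1)) i * i) = n - k"
        using sum_upd[OF k, of a "a k - 1"] a(2) by linarith
      then show "a(k := a k - 1) \<in> mult_functions m (n - k)"
        using a(1) k by (auto simp: mult_functions_def)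
      show "t * poisson_weight t m (a(k := a k - 1)) = real (k * a k) * poisson_weight t m a"
        using poisson_weight_upd[OF k, of "a(k := a k - 1)" t] a(3) eq by simp
    next
      fix a assume "a \<in> mult_functions m (n - k)"
      then have a: "\<And>i. i \<notin> {1..m} \<Longrightarrow> a i = 0" "(\<Sum>i=1..m. a i * i) = n - k"
        by (auto simp: mult_functions_def)
      show "(a(k := Suc (a k)))(k := (a(k := Suc (a k))) k - 1) = a" by simp
      have "(\<Sum>i=1..m. (a(k := Suc (a k))) i * i) = n"
        using sum_upd[OF k, of a "Suc (a k)"] a(2) True by simp
      then show "a(k := Suc (a k)) \<in> {a \<in> mult_functions m n. a k \<noteq> 0}"
        using a(1) k by (auto simp: mult_functions_def)
    qed
    then show ?thesis using True by (simp add: weight_sum_def sum_distrib_left)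
  next
    case False
    have "a k = 0" if "a \<in> mult_functions m n" for a
    proof (rule ccontr)
      assume "a k \<noteq> 0"
      then have "k \<le> a k * k" by simp
      also have "\<dots> \<le> (\<Sum>i=1..m. a i * i)"
        by (rule member_le_sum) (use k in auto)
      finally show False using that False by (simp add: mult_functions_def)
    qed
    then have "{a\<in>mult_functions m n. a k \<noteq> 0} = {}" by auto
    then show ?thesis using False by (simp only: sum.empty if_False)
  qed
  finally show ?thesis .
qed

text \<open>Writing \<open>n\<close> as the sum of all \<open>k * a k\<close> and exchanging the
  sums reduces this to the shift above. For the generating function F it is the equation z F'(z) = t
  (z + ... + z^m) F(z).\<close>

lemma weight_sum_rec:
  "real n * weight_sum t m n = t * (\<Sum>k | k \<in> {1..m} \<and> k \<le> n. weight_sum t m (n - k))"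
proof -
  have "real n * weight_sum t m n
      = (\<Sum>a\<in>mult_functions m n. \<Sum>k=1..m. real (k * a k) * poisson_weight t m a)"
    unfolding weight_sum_def sum_distrib_left
  proof (rule sum.cong)
    fix a assume "a \<in> mult_functions m n"
    then have "n = (\<Sum>k=1..m. k * a k)" by (simp add: mult_functions_def mult.commute)
    then have "real n = (\<Sum>k=1..m. real (k * a k))" by simp
    then show "real n * poisson_weight t m a = (\<Sum>k=1..m. real (k * a k) * poisson_weight t m a)"
      by (simp only: sum_distrib_right)
  qed simp
  also have "\<dots> = (\<Sum>k=1..m. if k \<le> n then t * weight_sum t m (n - k) else 0)"
    by (subst sum.swap) (intro sum.cong refl weighted_sum_shift)
  also have "\<dots> = (\<Sum>k | k \<in> {1..m} \<and> k \<le> n. t * weight_sum t m (n - k))"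
    by (subst sum.inter_filter[symmetric]) auto
  finally show ?thesis by (simp add: sum_distrib_left)
qed

text \<open>Dropping the restriction \<open>k \<le> m\<close> only adds nonnegative terms; the
  recursion then yields bounds uniform in \<open>m\<close>.\<close>

lemma weight_sum_rec_le:
  assumes "t \<ge> 0"
  shows "real n * weight_sum t m n \<le> t * (\<Sum>i<n. weight_sum t m i)"
proof -
  have "(\<Sum>k | k \<in> {1..m} \<and> k \<le> n. weight_sum t m (n - k)) \<le> (\<Sum>k=1..n. weight_sum t m (n - k))"
    by (rule sum_mono2) (auto intro: weight_sum_nonneg assms)
  also have "\<dots> = (\<Sum>i<n. weight_sum t m i)"
    by (rule sum.reindex_bij_witness[where i="\<lambda>i. n - i" and j="\<lambda>i. n - i"]) auto
  finally show ?thesis using assms by (simp add: weight_sum_rec mult_left_mono)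
qed

section \<open>Square-root decay of the total weight at parameter 1/2\<close>

text \<open>Each new term is at most the increment of \<open>2 * sqrt n\<close>. The
  \<open>- 1\<close> is kept because it later absorbs the term
  \<open>weight_sum t m 0 = 1\<close>.\<close>

lemma sum_inverse_sqrt_le:
  assumes "n \<ge> 1"
  shows "(\<Sum>i=1..n. 1 / sqrt (real i)) \<le> 2 * sqrt (real n) - 1"
  using assms
proof (induction n rule: nat_induct_at_least)
  case base
  then show ?case by simp
next
  case (Suc n)
  define a b where "a = sqrt (real n)" and "b = sqrt (real (Suc n))"
  have ab: "a > 0" "a \<le> b" "b\<^sup>2 = a\<^sup>2 + 1" "b > 0"
    using Suc by (auto simp: a_def b_def)
  have "2 * a * b + 1 \<le> 2 * b\<^sup>2"
    using ab(3) zero_le_power2[of "b - a"] by (simp add: power2_diff algebra_simps)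
  then have "1 / b \<le> 2 * b - 2 * a"
    using ab by (simp add: field_simps power2_eq_square)
  then show ?case using Suc by (simp add: a_def b_def)
qed

text \<open>The generating function of the weight sums is \<open>exp (t * (\<Sum>k=1..m. z ^ k / k))\<close>, which agrees with
  \<open>(1 - z) powr (- t)\<close> up to order \<open>m\<close>; so the coefficients decay like \<open>n powr (t - 1)\<close>.\<close>

lemma weight_sum_half_le:
  assumes "n \<ge> 1"
  shows "weight_sum (1/2) m n \<le> 1 / sqrt (real n)"
  using assms
proof (induction n rule: less_induct)
  case (less n)
  have "(\<Sum>i<n. weight_sum (1/2) m i) = 1 + (\<Sum>i=1..n-1. weight_sum (1/2) m i)"
  proof -
    have "{..<n} = insert 0 {1..n-1}" using less.prems by auto
    then show ?thesis by (simp add: weight_sum_0)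
  qed
  also have "\<dots> \<le> 1 + (\<Sum>i=1..n-1. 1 / sqrt (real i))"
    by (intro add_left_mono sum_mono less.IH) auto
  also have "\<dots> \<le> 2 * sqrt (real n)"
  proof (cases "n = 1")
    case False
    then have "(\<Sum>i=1..n-1. 1 / sqrt (real i)) \<le> 2 * sqrt (real (n - 1)) - 1"
      using less.prems by (intro sum_inverse_sqrt_le) auto
    moreover have "sqrt (real (n - 1)) \<le> sqrt (real n)" by simp
    ultimately show ?thesis by linarith
  qed simp
  finally have "real n * weight_sum (1/2) m n \<le> sqrt (real n)"
    using weight_sum_rec_le[of "1/2" n m] by simp
  then have "weight_sum (1/2) m n \<le> sqrt (real n) / real n"
    using less.prems by (simp add: field_simps)
  also have "\<dots> = 1 / sqrt (real n)"
    using less.prems by (simp add: field_simps)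
  finally show ?case .
qed

section \<open>Reduction of sumset membership to finitely many coordinates\<close>

text \<open>No part larger than \<open>n\<close> can be used in a sum equal to \<open>n\<close>. The
  finite form gives both measurability and a finite union bound.\<close>

lemma mem_sumset_iff:
  assumes "n \<le> m"
  shows "n \<in> sumset x \<longleftrightarrow> (\<exists>a\<in>mult_functions m n. \<forall>k\<in>{1..m}. a k \<le> x k)"
proof
  assume "n \<in> sumset x"
  then obtain a where a: "n = (\<Sum>k | 1 \<le> k \<and> a k \<noteq> 0. a k * k)" "\<And>k. k \<ge> 1 \<Longrightarrow> a k \<le> x k"
      "finite {k. 1 \<le> k \<and> a k \<noteq> 0}"
    by (auto simp: sumset_def)
  have le: "k \<le> m" if "1 \<le> k" "a k \<noteq> 0" for k
  proof -
    have "k \<le> a k * k" using that by simp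
    also have "\<dots> \<le> n" unfolding a(1)
      by (rule member_le_sum) (use that a(3) in auto)
    finally show ?thesis using assms by simp
  qed
  \<comment> \<open>\<open>sumset\<close> leaves \<open>a 0\<close> arbitrary, whereas
    \<open>mult_functions\<close> demands the value 0 there.\<close>
  let ?b = "\<lambda>k. if k = 0 then 0 else a k"
  have supp: "?b k = 0" if "k \<notin> {1..m}" for k
    using le[of k] that by (cases "k = 0") auto
  have "(\<Sum>k=1..m. ?b k * k) = n"
    unfolding a(1) by (rule sum.mono_neutral_cong_right) (use le in auto)
  then have "?b \<in> mult_functions m n"
    unfolding mult_functions_def using supp by blast
  then show "\<exists>a\<in>mult_functions m n. \<forall>k\<in>{1..m}. a k \<le> x k"
    by (rule bexI[rotated]) (use a(2) in auto)
next
  assume "\<exists>a\<in>mult_functions m n. \<forall>k\<in>{1..m}. a k \<le> x k"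
  then obtain a where a: "\<And>k. k \<notin> {1..m} \<Longrightarrow> a k = 0" "(\<Sum>k=1..m. a k * k) = n"
      "\<And>k. k \<in> {1..m} \<Longrightarrow> a k \<le> x k"
    unfolding mult_functions_def by blast
  have sub: "{k. 1 \<le> k \<and> a k \<noteq> 0} \<subseteq> {1..m}" using a(1) by fastforce
  have "a k \<le> x k" for k using a(1,3) by (cases "k \<in> {1..m}") auto
  moreover have "finite {k. 1 \<le> k \<and> a k \<noteq> 0}" using sub by (rule finite_subset) simp
  moreover have "(\<Sum>k | 1 \<le> k \<and> a k \<noteq> 0. a k * k) = n"
    unfolding a(2)[symmetric] by (rule sum.mono_neutral_left) (use sub in auto)
  ultimately show "n \<in> sumset x" by (auto simp: sumset_def intro!: exI[of _ a])
qed

section \<open>Analytic estimates for a Poisson variable and for harmonic numbers\<close>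

text \<open>After shifting the summation by \<open>a\<close>, the inequality
  \<open>fact a * fact x \<le> fact (x + a)\<close> splits off the factor
  \<open>(s * l) ^ a / fact a\<close>, and an exponential series remains.\<close>

lemma poisson_tilted_tail:
  assumes "l > 0" "s \<ge> 0"
  shows "(\<integral>\<^sup>+x. ennreal (of_bool (a \<le> x) * s ^ x) \<partial>measure_pmf (poisson_pmf l))
     \<le> ennreal (exp ((s - 1) * l) * ((s * l) ^ a / fact a))"
proof -
  define f where "f x = (s * l) ^ a / fact a * exp (-l) * ((s * l) ^ x / fact x)" for x :: nat
  have sl: "s * l \<ge> 0" using assms by simp
  have sums: "f sums (exp ((s - 1) * l) * ((s * l) ^ a / fact a))"
  proof -
    have "(\<lambda>x. (s * l) ^ x / fact x) sums exp (s * l)"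
      using exp_converges[of "s * l"] by (simp add: field_simps)
    then have "f sums ((s * l) ^ a / fact a * exp (-l) * exp (s * l))"
      unfolding f_def by (rule sums_mult)
    moreover have "exp (-l) * exp (s * l) = exp ((s - 1) * l)"
      by (simp add: exp_add[symmetric] algebra_simps)
    ultimately show ?thesis by (metis mult.assoc mult.commute)
  qed
  have f0: "f x \<ge> 0" for x using sl by (simp add: f_def)
  let ?g = "\<lambda>x. of_bool (a \<le> x) * s ^ x * (l ^ x / fact x * exp (- l))"
  have "(\<integral>\<^sup>+x. ennreal (of_bool (a \<le> x) * s ^ x) \<partial>measure_pmf (poisson_pmf l))
      = (\<Sum>x. ennreal (?g x))"
    using assms by (subst nn_integral_measure_pmf)
      (auto simp: nn_integral_count_space_nat ennreal_mult'[symmetric] mult_ac)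
  also have "\<dots> = (\<Sum>x. ennreal (?g (x + a)))"
    using suminf_offset[of "\<lambda>x. ennreal (?g x)" a] by simp
  also have "\<dots> \<le> (\<Sum>x. ennreal (f x))"
  proof (intro suminf_le ennreal_leI)
    fix x
    have "fact a * fact x \<le> (fact (x + a) :: real)"
      using fact_fact_dvd_fact[of a x] by (metis add.commute dvd_imp_le fact_gt_zero of_nat_fact of_nat_le_iff of_nat_mult)
    then have "(s * l) ^ (x + a) * exp (-l) / fact (x + a) \<le> (s * l) ^ (x + a) * exp (-l) / (fact a * fact x)"
      using sl by (intro divide_left_mono) auto
    then show "?g (x + a) \<le> f x"
      by (simp add: f_def power_add power_mult_distrib mult_ac)
  qed auto
  also have "\<dots> = ennreal (exp ((s - 1) * l) * ((s * l) ^ a / fact a))"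
    using sums f0 by (metis suminf_ennreal2 sums_summable sums_unique)
  finally show ?thesis .
qed

lemma harm_le_ln:
  assumes "m \<ge> 1"
  shows "harm m \<le> 1 + ln (real m)"
proof -
  obtain n where m: "m = Suc n" using assms by (cases m) auto
  have "harm (Suc n) - ln (real (Suc n)) \<le> harm (Suc 0) - ln (real (Suc 0))"
    using decseq_harm_diff_ln by (rule decseqD) simp
  then show ?thesis by (simp add: m harm_expand)
qed

section \<open>Tilted probability bounds for a single sample\<close>

context prob_space
begin

context
  fixes Y :: "nat \<Rightarrow> 'a \<Rightarrow> nat"
  assumes distr_Y: "\<And>k. k \<ge> 1 \<Longrightarrow>
      distr M (count_space UNIV) (Y k) = measure_pmf (poisson_pmf (1 / real k))"
    and indep_Y: "indep_vars (\<lambda>_. count_space UNIV) Y {1..}"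
begin

lemma rv_Y: "k \<ge> 1 \<Longrightarrow> Y k \<in> measurable M (count_space UNIV)"
  using indep_Y by (auto simp: indep_vars_def2)

text \<open>By independence the expectation factors over \<open>k\<close>; the exponents
  \<open>(s - 1) / k\<close> add up to \<open>(s - 1) * harm m\<close>.\<close>

lemma nn_integral_poisson_tilted:
  assumes "s \<ge> 0"
  shows "(\<integral>\<^sup>+\<omega>. (\<Prod>k=1..m. ennreal (of_bool (a k \<le> Y k \<omega>) * s ^ Y k \<omega>)) \<partial>M)
     \<le> ennreal (exp ((s - 1) * harm m) * poisson_weight s m a)"
proof -
  let ?g = "\<lambda>k x. ennreal (of_bool (a k \<le> x) * s ^ x)"
  have "indep_vars (\<lambda>_. borel) (\<lambda>k \<omega>. ?g k (Y k \<omega>)) {1..m}"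
    by (rule indep_vars_compose2[OF indep_vars_subset[OF indep_Y]]) auto
  then have "(\<integral>\<^sup>+\<omega>. (\<Prod>k=1..m. ?g k (Y k \<omega>)) \<partial>M) = (\<Prod>k=1..m. \<integral>\<^sup>+\<omega>. ?g k (Y k \<omega>) \<partial>M)"
    by (intro indep_vars_nn_integral) auto
  also have "\<dots> = (\<Prod>k=1..m. \<integral>\<^sup>+x. ?g k x \<partial>measure_pmf (poisson_pmf (1 / real k)))"
    by (intro prod.cong refl) (simp add: distr_Y[symmetric] nn_integral_distr rv_Y)
  also have "\<dots> \<le> (\<Prod>k=1..m. ennreal (exp ((s - 1) * (1 / real k)) * ((s * (1 / real k)) ^ a k / fact (a k))))"
    by (intro prod_mono_ennreal poisson_tilted_tail) (use assms in auto)
  also have "\<dots> = ennreal (\<Prod>k=1..m. exp ((s - 1) * (1 / real k)) * ((s * (1 / real k)) ^ a k / fact (a k)))"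
    using assms by (intro prod_ennreal) auto
  also have "\<dots> = ennreal (exp ((s - 1) * harm m) * poisson_weight s m a)"
    unfolding prod.distrib
    by (simp add: poisson_weight_def harm_def sum_distrib_left exp_sum divide_inverse)
  finally show ?thesis .
qed

text \<open>Markov's inequality for \<open>s ^ N\<close> on the event that the sample dominates
  \<open>a\<close>, where \<open>N\<close> is the number of parts. Phrasing the condition through
  powers of \<open>s\<close> serves both tails: it means \<open>N \<ge> u\<close> for
  \<open>s > 1\<close> and \<open>N \<le> u\<close> for \<open>s < 1\<close>.\<close>

lemma prob_tilted:
  assumes "s > 0"
  shows "prob {\<omega> \<in> space M. (\<forall>k\<in>{1..m}. a k \<le> Y k \<omega>) \<and> s powr u \<le> s ^ (\<Sum>k=1..m. Y k \<omega>)}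
     \<le> s powr (- u) * exp ((s - 1) * harm m) * poisson_weight s m a"
proof -
  let ?A = "{\<omega> \<in> space M. (\<forall>k\<in>{1..m}. a k \<le> Y k \<omega>) \<and> s powr u \<le> s ^ (\<Sum>k=1..m. Y k \<omega>)}"
  have [measurable]: "Y k \<in> measurable M (count_space UNIV)" if "k \<in> {1..m}" for k
    using that rv_Y by simp
  have [measurable]: "?A \<in> sets M" by measurable
  have "emeasure M ?A = (\<integral>\<^sup>+\<omega>. indicator ?A \<omega> \<partial>M)" by simp
  also have "\<dots> \<le> (\<integral>\<^sup>+\<omega>. ennreal (s powr (- u)) * (\<Prod>k=1..m. ennreal (of_bool (a k \<le> Y k \<omega>) * s ^ Y k \<omega>)) \<partial>M)"
  proof (intro nn_integral_mono)
    fix \<omega>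
    have "1 \<le> s powr (- u) * (\<Prod>k=1..m. of_bool (a k \<le> Y k \<omega>) * s ^ Y k \<omega>)" if "\<omega> \<in> ?A"
    proof -
      have "(\<Prod>k=1..m. of_bool (a k \<le> Y k \<omega>) * s ^ Y k \<omega>) = (\<Prod>k=1..m. s ^ Y k \<omega>)"
        using that by (intro prod.cong) auto
      also have "\<dots> \<ge> s powr u" using that by (simp add: power_sum)
      finally have "s powr (- u) * s powr u \<le> s powr (- u) * (\<Prod>k=1..m. of_bool (a k \<le> Y k \<omega>) * s ^ Y k \<omega>)"
        by (intro mult_left_mono) auto
      then show ?thesis using assms by (simp add: powr_minus)
    qed
    then have "indicator ?A \<omega> \<le> ennreal (s powr (- u) * (\<Prod>k=1..m. of_bool (a k \<le> Y k \<omega>) * s ^ Y k \<omega>))"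
      by (auto simp: indicator_def)
    also have "\<dots> = ennreal (s powr (- u)) * ennreal (\<Prod>k=1..m. of_bool (a k \<le> Y k \<omega>) * s ^ Y k \<omega>)"
      by (rule ennreal_mult') simp
    also have "ennreal (\<Prod>k=1..m. of_bool (a k \<le> Y k \<omega>) * s ^ Y k \<omega>)
        = (\<Prod>k=1..m. ennreal (of_bool (a k \<le> Y k \<omega>) * s ^ Y k \<omega>))"
      by (rule prod_ennreal[symmetric]) (use assms in simp)
    finally show "indicator ?A \<omega> \<le> ennreal (s powr (- u)) * (\<Prod>k=1..m. ennreal (of_bool (a k \<le> Y k \<omega>) * s ^ Y k \<omega>))" .
  qed
  also have "\<dots> = ennreal (s powr (- u)) * (\<integral>\<^sup>+\<omega>. (\<Prod>k=1..m. ennreal (of_bool (a k \<le> Y k \<omega>) * s ^ Y k \<omega>)) \<partial>M)"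
    by (rule nn_integral_cmult) measurable
  also have "\<dots> \<le> ennreal (s powr (- u)) * ennreal (exp ((s - 1) * harm m) * poisson_weight s m a)"
    by (intro mult_left_mono nn_integral_poisson_tilted) (use assms in auto)
  also have "\<dots> = ennreal (s powr (- u) * exp ((s - 1) * harm m) * poisson_weight s m a)"
    by (simp add: ennreal_mult'[symmetric] mult.assoc)
  finally show ?thesis
    using assms by (simp add: emeasure_eq_measure poisson_weight_nonneg)
qed

text \<open>The Chernoff bound: for \<open>a = 0\<close> the domination condition is vacuous and the
  weight is 1.\<close>

lemma prob_count_gt:
  assumes "s > 1"
  shows "prob {\<omega> \<in> space M. u < real (\<Sum>k=1..m. Y k \<omega>)} \<le> s powr (- u) * exp ((s - 1) * harm m)"
proof -
  have [measurable]: "Y k \<in> measurable M (count_space UNIV)" if "k \<in> {1..m}" for k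
    using that rv_Y by simp
  have "prob {\<omega> \<in> space M. u < real (\<Sum>k=1..m. Y k \<omega>)}
     \<le> prob {\<omega> \<in> space M. (\<forall>k\<in>{1..m}. 0 \<le> Y k \<omega>) \<and> s powr u \<le> s ^ (\<Sum>k=1..m. Y k \<omega>)}"
    using assms by (intro finite_measure_mono) (auto simp flip: powr_realpow)
  also have "\<dots> \<le> s powr (- u) * exp ((s - 1) * harm m) * poisson_weight s m (\<lambda>_. 0)"
    by (rule prob_tilted) (use assms in simp)
  finally show ?thesis by (simp add: poisson_weight_def)
qed

text \<open>A union bound over the multiplicity functions, each treated with the tilt 1/2. One
  square root comes from \<open>harm m \<ge> ln m\<close>, the other from the decay of
  \<open>weight_sum (1/2) m n\<close>.\<close>

lemma prob_mem_sumset_few: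
  assumes "n \<ge> 1" "n \<le> m"
  shows "prob {\<omega> \<in> space M. n \<in> sumset (\<lambda>k. Y k \<omega>) \<and> real (\<Sum>k=1..m. Y k \<omega>) \<le> u}
     \<le> 2 powr u / (sqrt (real m) * sqrt (real n))"
proof -
  have [measurable]: "Y k \<in> measurable M (count_space UNIV)" if "k \<in> {1..m}" for k
    using that rv_Y by simp
  let ?A = "\<lambda>a. {\<omega> \<in> space M. (\<forall>k\<in>{1..m}. a k \<le> Y k \<omega>) \<and>
      (1/2) powr u \<le> (1/2) ^ (\<Sum>k=1..m. Y k \<omega>)}"
  have exp_harm: "exp (- (harm m / 2)) \<le> 1 / sqrt (real m)"
  proof -
    have "ln (real m) \<le> ln (real m + 1)" using assms by simp
    then have "ln (real m) \<le> harm m" using ln_le_harm[of m] by linarith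
    then have "exp (- (harm m / 2)) \<le> exp (- (ln (real m) / 2))" by simp
    also have "\<dots> = 1 / sqrt (real m)"
      using assms by (simp add: exp_minus ln_sqrt[symmetric] inverse_eq_divide)
    finally show ?thesis .
  qed
  have A_sets: "?A a \<in> sets M" for a by measurable
  have "prob {\<omega> \<in> space M. n \<in> sumset (\<lambda>k. Y k \<omega>) \<and> real (\<Sum>k=1..m. Y k \<omega>) \<le> u}
     \<le> prob (\<Union>a\<in>mult_functions m n. ?A a)"
  proof (rule finite_measure_mono)
    have "(1/2) powr u \<le> (1/2::real) ^ N" if "real N \<le> u" for N
      using powr_mono'[OF that, of "1/2"] by (simp add: powr_realpow)
    then show "{\<omega> \<in> space M. n \<in> sumset (\<lambda>k. Y k \<omega>) \<and> real (\<Sum>k=1..m. Y k \<omega>) \<le> u}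
        \<subseteq> (\<Union>a\<in>mult_functions m n. ?A a)"
      unfolding mem_sumset_iff[OF assms(2)] by blast
    show "(\<Union>a\<in>mult_functions m n. ?A a) \<in> sets M"
      by (rule sets.finite_UN[OF finite_mult_functions A_sets])
  qed
  also have "\<dots> \<le> (\<Sum>a\<in>mult_functions m n. prob (?A a))"
    by (rule finite_measure_subadditive_finite[OF finite_mult_functions]) (use A_sets in blast)
  also have "\<dots> \<le> (\<Sum>a\<in>mult_functions m n. (1/2) powr (- u) * exp ((1/2 - 1) * harm m) * poisson_weight (1/2) m a)"
    by (intro sum_mono prob_tilted) simp
  also have "\<dots> = 2 powr u * exp (- (harm m / 2)) * weight_sum (1/2) m n"
  proof -
    have "(1/2) powr (- u) = (2::real) powr u"
      by (simp add: powr_divide powr_minus)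
    moreover have "(1/2 - 1) * harm m = - (harm m / 2 :: real)" by simp
    ultimately show ?thesis
      by (simp only: weight_sum_def sum_distrib_left)
  qed
  also have "\<dots> \<le> 2 powr u * (1 / sqrt (real m)) * (1 / sqrt (real n))"
    using exp_harm by (intro mult_mono mult_left_mono weight_sum_half_le)
      (use assms in \<open>auto simp: weight_sum_nonneg\<close>)
  finally show ?thesis by simp
qed

end

end

section \<open>Independence between the samples\<close>

text \<open>Independence is given for whole sequences as elements of the product space. Since
  \<open>n \<le> m\<close>, each event depends only on the coordinates in \<open>{1..m}\<close> and
  is the preimage of one measurable set, the same for all \<open>r\<close>.\<close>

lemma (in prob_space) prob_INT_mem_sumset_few:
  fixes X :: "'i \<Rightarrow> nat \<Rightarrow> 'a \<Rightarrow> nat"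
  assumes indep: "indep_vars (\<lambda>_. \<Pi>\<^sub>M k\<in>{1..}. count_space (UNIV :: nat set))
      (\<lambda>r \<omega>. \<lambda>k\<in>{1..}. X r k \<omega>) I"
    and I: "finite I" "I \<noteq> {}" and n: "n \<le> m"
  shows "prob (\<Inter>r\<in>I. {\<omega> \<in> space M. n \<in> sumset (\<lambda>k. X r k \<omega>) \<and> real (\<Sum>k=1..m. X r k \<omega>) \<le> u})
    = (\<Prod>r\<in>I. prob {\<omega> \<in> space M. n \<in> sumset (\<lambda>k. X r k \<omega>) \<and> real (\<Sum>k=1..m. X r k \<omega>) \<le> u})"
proof -
  let ?P = "\<Pi>\<^sub>M k\<in>{1..}. count_space (UNIV :: nat set)"
  let ?A = "{x \<in> space ?P. (\<exists>a\<in>mult_functions m n. \<forall>k\<in>{1..m}. a k \<le> x k) \<and>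
      real (\<Sum>k=1..m. x k) \<le> u}"
  have [measurable]: "(\<lambda>x. x k) \<in> measurable ?P (count_space UNIV)" if "k \<in> {1..m}" for k
    by (rule measurable_component_singleton) (use that in auto)
  \<comment> \<open>Countability makes the existential quantifier in \<open>?A\<close> a countable
    union of measurable sets.\<close>
  have [simp]: "countable (mult_functions m n)"
    by (rule countable_finite) (rule finite_mult_functions)
  have A: "?A \<in> sets ?P"
    by measurable
  have eq: "(\<lambda>\<omega>. \<lambda>k\<in>{1..}. X r k \<omega>) -` ?A \<inter> space M
      = {\<omega> \<in> space M. n \<in> sumset (\<lambda>k. X r k \<omega>) \<and> real (\<Sum>k=1..m. X r k \<omega>) \<le> u}" for r
    by (auto simp: mem_sumset_iff[OF n] space_PiM)
  show ?thesis
    using indep_varsD_finite[OF indep I(2,1), of "\<lambda>_. ?A", OF A] unfolding eq .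
qed

section \<open>Borel--Cantelli over dyadic blocks\<close>

theorem theorem3p2:
  fixes M :: "'a measure" and X :: "nat \<Rightarrow> nat \<Rightarrow> 'a \<Rightarrow> nat"
  assumes "prob_space M"
    and "\<And>r k. r \<in> {1..4} \<Longrightarrow> k \<ge> 1 \<Longrightarrow>
           distr M (count_space UNIV) (X r k) = measure_pmf (poisson_pmf (1 / real k))"
    and "\<And>r. r \<in> {1..4} \<Longrightarrow>
           prob_space.indep_vars M (\<lambda>_. count_space UNIV) (X r) {1..}"
    and "prob_space.indep_vars M (\<lambda>_. \<Pi>\<^sub>M k\<in>{1..}. count_space (UNIV :: nat set))
           (\<lambda>r \<omega>. \<lambda>k\<in>{1..}. X r k \<omega>) {1..4}"
  shows "AE \<omega> in M. finite (\<Inter>r\<in>{1..4}. sumset (\<lambda>k. X r k \<omega>))"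
proof -
  interpret prob_space M by fact
  have rv [measurable]: "X r k \<in> measurable M (count_space UNIV)" if "r \<in> {1..4}" "k \<in> {1..}" for r k
    using rv_Y[OF assms(2,3)] that by simp
  define m :: "nat \<Rightarrow> nat" where "m J = 2 ^ (J + 1)" for J
  \<comment> \<open>The slope has to exceed \<open>ln 2\<close>, the growth rate of the mean count
    in \<open>J\<close>, and to stay below 3/4, so that four factors \<open>2 powr (u J - J)\<close>
    beat the \<open>2 ^ J\<close> values of \<open>n\<close> in a block.\<close>
  define u :: "nat \<Rightarrow> real" where "u J = 37 / 50 * real J" for J
  define few where "few r n J = {\<omega> \<in> space M. n \<in> sumset (\<lambda>k. X r k \<omega>) \<and>
      real (\<Sum>k=1..m J. X r k \<omega>) \<le> u J}" for r n J
  define many where "many r J = {\<omega> \<in> space M. u J < real (\<Sum>k=1..m J. X r k \<omega>)}" for r J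
  define hit where "hit J = (\<Union>n\<in>{2^J..<2^(J+1)}. \<Inter>r\<in>{1..4}. few r n J)" for J

  have many_sets: "many r J \<in> sets M" if "r \<in> {1..4}" for r J
    unfolding many_def using that by measurable
  have few_sets: "few r n J \<in> sets M" if "r \<in> {1..4}" "n \<le> m J" for r n J
  proof -
    have [simp]: "countable (mult_functions (m J) n)"
      by (rule countable_finite) (rule finite_mult_functions)
    show ?thesis unfolding few_def mem_sumset_iff[OF that(2)] using that(1) by measurable
  qed
  have INT_few_sets: "(\<Inter>r\<in>{1..4}. few r n J) \<in> sets M" if "n \<le> m J" for n J
    by (rule sets.finite_INT) (use few_sets that in auto)
  have hit_sets: "hit J \<in> sets M" for J
    unfolding hit_def by (intro sets.finite_UN INT_few_sets) (auto simp: m_def)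

  have many_summable: "summable (\<lambda>J. prob (many r J))" if r: "r \<in> {1..4}" for r
  proof (rule summable_comparison_test)
    \<comment> \<open>This is the exponential rate in \<open>J\<close> of the Chernoff bound with
      \<open>s = 26/25\<close>. It is negative: \<open>ln 2 \<le> 25/36\<close> bounds the first
      term by 1/36 < 0.0278, and \<open>ln (1 + x) \<ge> x - x^2\<close> at \<open>x = 1/25\<close>
      makes the subtracted term at least 0.0284.\<close>
    define c :: real where "c = 1 / 25 * ln 2 - 37 / 50 * ln (26 / 25)"
    have "c < 0"
      using ln_one_plus_pos_lower_bound[of "1/25"] ln2_le_25_over_36
      by (simp add: c_def power2_eq_square)
    then show "summable (\<lambda>J. exp (1 / 25 * (1 + ln 2)) * exp c ^ J)"
      by (intro summable_mult summable_geometric) simp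
    have "prob (many r J) \<le> exp (1 / 25 * (1 + ln 2)) * exp c ^ J" for J
    proof -
      have "prob (many r J) \<le> (26/25) powr (- u J) * exp ((26/25 - 1) * harm (m J))"
        unfolding many_def by (rule prob_count_gt[OF assms(2,3)]) (use r in auto)
      also have "\<dots> \<le> (26/25) powr (- u J) * exp ((26/25 - 1) * (1 + ln (real (m J))))"
        using harm_le_ln[of "m J"] by (simp add: m_def)
      also have "ln (real (m J)) = (real J + 1) * ln 2"
        by (simp add: m_def ln_mult ln_realpow algebra_simps)
      also have "(26/25) powr (- u J) * exp ((26/25 - 1) * (1 + (real J + 1) * ln 2))
          = exp (1 / 25 * (1 + ln 2)) * exp c ^ J"
      proof -
        have "(26/25) powr (- u J) * exp ((26/25 - 1) * (1 + (real J + 1) * ln 2))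
            = exp (- u J * ln (26/25) + (26/25 - 1) * (1 + (real J + 1) * ln 2))"
          unfolding exp_add by (simp add: powr_def)
        also have "- u J * ln (26/25) + (26/25 - 1) * (1 + (real J + 1) * ln 2)
            = 1 / 25 * (1 + ln 2) + real J * c"
          unfolding u_def c_def by argo
        finally show ?thesis by (simp only: exp_add exp_of_nat_mult)
      qed
      finally show ?thesis .
    qed
    then show "\<exists>N. \<forall>J\<ge>N. norm (prob (many r J)) \<le> exp (1 / 25 * (1 + ln 2)) * exp c ^ J"
      by simp
  qed

  have few_prob: "prob (few r n J) \<le> 2 powr (- (13 / 50) * real J)"
    if "r \<in> {1..4}" "n \<in> {2^J..<2^(J+1)}" for r n J
  proof -
    have n: "2 ^ J \<le> n" "n \<le> m J" "1 \<le> n" "(2::nat) ^ J \<le> m J"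
      using that(2) by (auto simp: m_def intro: order.trans[of 1 "2 ^ J"])
    have "prob (few r n J) \<le> 2 powr u J / (sqrt (real (m J)) * sqrt (real n))"
      unfolding few_def by (rule prob_mem_sumset_few[OF assms(2,3)]) (use that n in auto)
    \<comment> \<open>Both \<open>n\<close> and \<open>m J\<close> are at least
      \<open>2 ^ J\<close>, so the denominator contributes a full factor
      \<open>2 ^ J\<close>.\<close>
    also have "\<dots> \<le> 2 powr u J / (sqrt (2 ^ J) * sqrt (2 ^ J))"
    proof (intro divide_left_mono mult_mono)
      show "sqrt (2 ^ J) \<le> sqrt (real n)" "sqrt (2 ^ J) \<le> sqrt (real (m J))"
        using of_nat_mono[OF n(1), where 'a=real] of_nat_mono[OF n(4), where 'a=real] by simp_all
    qed (use n in \<open>auto simp: m_def\<close>)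
    also have "\<dots> = 2 powr (u J - real J)"
      by (simp add: powr_diff powr_realpow)
    also have "u J - real J = - (13 / 50) * real J" by (simp add: u_def)
    finally show ?thesis .
  qed

  have hit_summable: "summable (\<lambda>J. prob (hit J))"
  proof (rule summable_comparison_test)
    show "summable (\<lambda>J. (2 powr (- 1 / 25) :: real) ^ J)"
      by (rule summable_geometric) (simp add: powr_less_one)
    have "prob (hit J) \<le> (2 powr (- 1 / 25)) ^ J" for J
    proof -
      have le: "n \<le> m J" if "n \<in> {2^J..<2^(J+1)}" for n
        using that by (simp add: m_def)
      have "prob (hit J) \<le> (\<Sum>n\<in>{2^J..<2^(J+1)}. prob (\<Inter>r\<in>{1..4}. few r n J))"
        unfolding hit_def
        by (rule finite_measure_subadditive_finite) (use INT_few_sets le in auto)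
      also have "\<dots> = (\<Sum>n\<in>{2^J..<2^(J+1)}. \<Prod>r\<in>{1..4}. prob (few r n J))"
        unfolding few_def by (intro sum.cong refl prob_INT_mem_sumset_few assms(4) le) auto
      also have "\<dots> \<le> (\<Sum>n\<in>{2^J..<2^(J+1)::nat}. \<Prod>r\<in>{1..4::nat}. 2 powr (- (13 / 50) * real J))"
        by (intro sum_mono prod_mono conjI few_prob) auto
      \<comment> \<open>The block has \<open>2 ^ J\<close> elements, and the net exponent is
        \<open>J - 4 * 13/50 * J = - J / 25\<close>.\<close>
      also have "\<dots> = 2 ^ J * (2 powr (- (13 / 50) * real J)) ^ 4"
        by simp
      also have "\<dots> = (2 powr (- 1 / 25)) ^ J"
      proof -
        have "(2::real) ^ J * (2 powr (- (13 / 50) * real J)) ^ 4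
            = 2 powr real J * 2 powr (- (13 / 50) * real J * 4)"
          by (simp add: powr_power powr_realpow)
        also have "\<dots> = 2 powr (- 1 / 25 * real J)"
          unfolding powr_add[symmetric] by (rule arg_cong) simp
        also have "\<dots> = (2 powr (- 1 / 25)) ^ J"
          by (simp add: powr_power)
        finally show ?thesis .
      qed
      finally show ?thesis .
    qed
    then show "\<exists>N. \<forall>J\<ge>N. norm (prob (hit J)) \<le> (2 powr (- 1 / 25)) ^ J"
      by simp
  qed

  have "AE \<omega> in M. eventually (\<lambda>J. \<omega> \<in> space M - hit J) sequentially"
    by (rule borel_cantelli_AE1) (use hit_sets hit_summable in \<open>auto simp: emeasure_eq_measure\<close>)
  moreover have "AE \<omega> in M. \<forall>r\<in>{1..4}. eventually (\<lambda>J. \<omega> \<in> space M - many r J) sequentially"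
  proof (rule AE_ball_countable', goal_cases)
    case (1 r)
    then show ?case
      by (intro borel_cantelli_AE1) (use many_sets many_summable in \<open>auto simp: emeasure_eq_measure\<close>)
  qed simp
  ultimately show ?thesis
  proof eventually_elim
    case (elim \<omega>)
    have "eventually (\<lambda>J. \<omega> \<in> space M - hit J \<and> (\<forall>r\<in>{1..4}. \<omega> \<in> space M - many r J)) sequentially"
      using elim by (intro eventually_conj eventually_ball_finite) auto
    then obtain J0 where J0: "\<And>J. J \<ge> J0 \<Longrightarrow> \<omega> \<in> space M - hit J"
        "\<And>J r. J \<ge> J0 \<Longrightarrow> r \<in> {1..4} \<Longrightarrow> \<omega> \<in> space M - many r J"
      unfolding eventually_sequentially by blast
    \<comment> \<open>A larger \<open>n\<close> would lie in a dyadic block with index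
      \<open>J \<ge> J0\<close>. There all four counts are at most \<open>u J\<close>, so the
      outcome would belong to \<open>hit J\<close>, which is excluded beyond
      \<open>J0\<close>.\<close>
    have "n < 2 ^ J0" if n: "n \<in> (\<Inter>r\<in>{1..4}. sumset (\<lambda>k. X r k \<omega>))" for n
    proof (rule ccontr)
      assume "\<not> n < 2 ^ J0"
      then have ge: "2 ^ J0 \<le> n" by simp
      then have "n > 0" by (metis gr0I not_less zero_less_numeral zero_less_power)
      then obtain J where J: "2 ^ J \<le> n" "n < 2 ^ (J + 1)"
        using ex_power_ivl1[of 2 n] by auto
      have "(2::nat) ^ J0 < 2 ^ (J + 1)" using ge J(2) by (rule le_less_trans)
      then have "J0 \<le> J" using power_less_imp_less_exp[of "2::nat" J0 "J + 1"] by simp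
      note J0 = J0[OF this]
      have "\<omega> \<in> few r n J" if "r \<in> {1..4}" for r
        using n that J0(2)[OF that] by (auto simp: few_def many_def not_less)
      moreover have "n \<in> {2^J..<2^(J+1)}" using J by simp
      ultimately have "\<omega> \<in> hit J" unfolding hit_def by blast
      then show False using J0(1) by simp
    qed
    then have "(\<Inter>r\<in>{1..4}. sumset (\<lambda>k. X r k \<omega>)) \<subseteq> {..<2 ^ J0}" by blast
    then show ?case by (rule finite_subset) simp
  qed
qed

end
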